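(* Let $v$ be a positive integer and, for $1\le i\le v$, let $(X_i,\kappa_i)$ and $(Y_i,\lambda_i)$ be digital images with $X_i\simeq_{\kappa_i,\lambda_i} Y_i$ (same homotopy type). Then $X=\prod_{i=1}^v X_i$ with adjacency $NP_v(\kappa_1,\ldots,\kappa_v)$ and $Y=\prod_{i=1}^v Y_i$ with adjacency $NP_v(\lambda_1,\ldots,\lambda_v)$ have the same homotopy type: $$X\simeq_{NP_v(\kappa_1,\ldots,\kappa_v),NP_v(\lambda_1,\ldots,\lambda_v)} Y.$$ Further, if the homotopy equivalences $X_i\simeq Y_i$ are all pointed with respect to $x_i\in X_i$ and $y_i\in Y_i$, then the homotopy equivalence $X\simeq Y$ is pointed with respect to $(x_1,\ldots,x_v)\in X$ and $(y_1,\ldots,y_v)\in Y$.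
   Context: A digital image $(X,\kappa)$ is a set $X$ (of lattice points in some $\mathbb{Z}^n$) with an adjacency relation $\kappa$, i.e. a symmetric irreflexive binary relation on $X$. A function $f:(X,\kappa)\to(Y,\lambda)$ is continuous if for all $\kappa$-adjacent $x,x'\in X$ the points $f(x),f(x')$ are equal or $\lambda$-adjacent. $[a,b]_{\mathbb{Z}}=\{z\in\mathbb{Z}: a\le z\le b\}$, with $c_1$-adjacency ($t,t'$ adjacent iff $|t-t'|=1$). Homotopy: for continuous $f,g:(X,\kappa)\to(Y,\lambda)$, a homotopy from $f$ to $g$ is a function $F:X\times[0,m]_{\mathbb{Z}}\to Y$, for some positive integer $m$, such that $F(x,0)=f(x)$ and $F(x,m)=g(x)$ for all $x$; for each $x$, $t\mapsto F(x,t)$ is $(c_1,\lambda)$-continuous; and for each $t$, $x\mapsto F(x,t)$ is $(\kappa,\lambda)$-continuous. It holds $x$ fixed if $F(x,t)=F(x,0)$ for all $t$. If a homotopy exists we write $f\simeq g$. $(X,\kappa)$ and $(Y,\lambda)$ have the same homotopy type, $X\simeq_{\kappa,\lambda}Y$, if there are continuous $f:X\to Y$, $g:Y\to X$ with $g\circ f\simeq 1_X$ and $f\circ g\simeq 1_Y$. The equivalence is pointed with respect to $x_0\in X$, $y_0\in Y$ if $f,g$ and the homotopies can be chosen with $f(x_0)=y_0$, $g(y_0)=x_0$, the homotopy $g\circ f\simeq 1_X$ holding $x_0$ fixed and the homotopy $f\circ g\simeq 1_Y$ holding $y_0$ fixed. $NP_v(\kappa_1,\dots,\kappa_v)$-adjacency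 on $\prod_{i=1}^v X_i$: two distinct points $(x_1,\dots,x_v)$ and $(x_1',\dots,x_v')$ are adjacent iff for every $i$, $x_i$ and $x_i'$ are equal or $\kappa_i$-adjacent. *)

theory Defs
  imports Main "HOL-Library.FuncSet"
begin

text \<open>A point of $Z^n$ is an integer list of length \<open>n\<close>. The ambient dimension is not
  part of the type, so a family of images may live in lattices of different dimensions.\<close>

definition lattice :: "nat \<Rightarrow> int list set" where
  "lattice n = {p. length p = n}"

text \<open>Only the restriction of the relation to the underlying set matters.\<close>

definition digital_image :: "int list set \<Rightarrow> (int list \<Rightarrow> int list \<Rightarrow> bool) \<Rightarrow> bool" where
  "digital_image X \<kappa> \<longleftrightarrow> (\<exists>n. X \<subseteq> lattice n) \<and> symp_on X \<kappa> \<and> irreflp_on X \<kappa>"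

text \<open>Maps between images are HOL functions, of which only the values on the domain matter. The
  notions below are polymorphic because they also apply to integer intervals (as time parameter).\<close>

definition dig_continuous ::
  "'a set \<Rightarrow> ('a \<Rightarrow> 'a \<Rightarrow> bool) \<Rightarrow> 'b set \<Rightarrow> ('b \<Rightarrow> 'b \<Rightarrow> bool) \<Rightarrow> ('a \<Rightarrow> 'b) \<Rightarrow> bool" where
  "dig_continuous X \<kappa> Y \<mu> f \<longleftrightarrow>
     f \<in> X \<rightarrow> Y \<and> (\<forall>x\<in>X. \<forall>x'\<in>X. \<kappa> x x' \<longrightarrow> f x = f x' \<or> \<mu> (f x) (f x'))"

definition c1_adj :: "int \<Rightarrow> int \<Rightarrow> bool" where
  "c1_adj t t' \<longleftrightarrow> \<bar>t - t'\<bar> = 1"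

definition dig_homotopy ::
  "'a set \<Rightarrow> ('a \<Rightarrow> 'a \<Rightarrow> bool) \<Rightarrow> 'b set \<Rightarrow> ('b \<Rightarrow> 'b \<Rightarrow> bool) \<Rightarrow>
   ('a \<Rightarrow> 'b) \<Rightarrow> ('a \<Rightarrow> 'b) \<Rightarrow> int \<Rightarrow> ('a \<times> int \<Rightarrow> 'b) \<Rightarrow> bool" where
  "dig_homotopy X \<kappa> Y \<mu> f g m F \<longleftrightarrow>
     dig_continuous X \<kappa> Y \<mu> f \<and> dig_continuous X \<kappa> Y \<mu> g \<and>
     m > 0 \<and> F \<in> X \<times> {0..m} \<rightarrow> Y \<and>
     (\<forall>x\<in>X. F (x, 0) = f x \<and> F (x, m) = g x) \<and>
     (\<forall>x\<in>X. dig_continuous {0..m} c1_adj Y \<mu> (\<lambda>t. F (x, t))) \<and>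
     (\<forall>t\<in>{0..m}. dig_continuous X \<kappa> Y \<mu> (\<lambda>x. F (x, t)))"

definition holds_fixed :: "int \<Rightarrow> ('a \<times> int \<Rightarrow> 'b) \<Rightarrow> 'a \<Rightarrow> bool" where
  "holds_fixed m F x \<longleftrightarrow> (\<forall>t\<in>{0..m}. F (x, t) = F (x, 0))"

definition dig_homotopic ::
  "'a set \<Rightarrow> ('a \<Rightarrow> 'a \<Rightarrow> bool) \<Rightarrow> 'b set \<Rightarrow> ('b \<Rightarrow> 'b \<Rightarrow> bool) \<Rightarrow>
   ('a \<Rightarrow> 'b) \<Rightarrow> ('a \<Rightarrow> 'b) \<Rightarrow> bool" where
  "dig_homotopic X \<kappa> Y \<mu> f g \<longleftrightarrow> (\<exists>m F. dig_homotopy X \<kappa> Y \<mu> f g m F)"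

definition dig_homotopic_fixing ::
  "'a \<Rightarrow> 'a set \<Rightarrow> ('a \<Rightarrow> 'a \<Rightarrow> bool) \<Rightarrow> 'b set \<Rightarrow> ('b \<Rightarrow> 'b \<Rightarrow> bool) \<Rightarrow>
   ('a \<Rightarrow> 'b) \<Rightarrow> ('a \<Rightarrow> 'b) \<Rightarrow> bool" where
  "dig_homotopic_fixing x0 X \<kappa> Y \<mu> f g \<longleftrightarrow>
     (\<exists>m F. dig_homotopy X \<kappa> Y \<mu> f g m F \<and> holds_fixed m F x0)"

definition same_homotopy_type ::
  "'a set \<Rightarrow> ('a \<Rightarrow> 'a \<Rightarrow> bool) \<Rightarrow> 'b set \<Rightarrow> ('b \<Rightarrow> 'b \<Rightarrow> bool) \<Rightarrow> bool" where
  "same_homotopy_type X \<kappa> Y \<mu> \<longleftrightarrow>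
     (\<exists>f g. dig_continuous X \<kappa> Y \<mu> f \<and> dig_continuous Y \<mu> X \<kappa> g \<and>
        dig_homotopic X \<kappa> X \<kappa> (g \<circ> f) id \<and> dig_homotopic Y \<mu> Y \<mu> (f \<circ> g) id)"

definition pointed_same_homotopy_type ::
  "'a set \<Rightarrow> ('a \<Rightarrow> 'a \<Rightarrow> bool) \<Rightarrow> 'a \<Rightarrow> 'b set \<Rightarrow> ('b \<Rightarrow> 'b \<Rightarrow> bool) \<Rightarrow> 'b \<Rightarrow> bool" where
  "pointed_same_homotopy_type X \<kappa> x0 Y \<mu> y0 \<longleftrightarrow>
     x0 \<in> X \<and> y0 \<in> Y \<and>
     (\<exists>f g. dig_continuous X \<kappa> Y \<mu> f \<and> dig_continuous Y \<mu> X \<kappa> g \<and>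
        f x0 = y0 \<and> g y0 = x0 \<and>
        dig_homotopic_fixing x0 X \<kappa> X \<kappa> (g \<circ> f) id \<and>
        dig_homotopic_fixing y0 Y \<mu> Y \<mu> (f \<circ> g) id)"

text \<open>The tuple $(p_1,\dots,p_v)$ of lattice points, as a point of the lattice whose dimension is the
  sum of the dimensions, is the concatenation of the coordinate lists. This makes the product
  of digital images a digital image again; see \<open>tuple_inject\<close> and
  \<open>digital_image_prod\<close> below.\<close>

definition tuple :: "nat \<Rightarrow> (nat \<Rightarrow> int list) \<Rightarrow> int list" where
  "tuple v p = concat (map p [1..<Suc v])"

definition image_prod :: "nat \<Rightarrow> (nat \<Rightarrow> int list set) \<Rightarrow> int list set" where
  "image_prod v X = {tuple v p | p. \<forall>i\<in>{1..v}. p i \<in> X i}"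

text \<open>The sets \<open>X i\<close> are an argument because the components of a concatenated point are
  recovered as elements of these sets.\<close>

definition NP_adj ::
  "nat \<Rightarrow> (nat \<Rightarrow> int list set) \<Rightarrow> (nat \<Rightarrow> int list \<Rightarrow> int list \<Rightarrow> bool) \<Rightarrow>
   int list \<Rightarrow> int list \<Rightarrow> bool" where
  "NP_adj v X \<kappa> z z' \<longleftrightarrow>
     (\<exists>p p'. (\<forall>i\<in>{1..v}. p i \<in> X i) \<and> (\<forall>i\<in>{1..v}. p' i \<in> X i) \<and>
        z = tuple v p \<and> z' = tuple v p' \<and> z \<noteq> z' \<and>
        (\<forall>i\<in>{1..v}. p i = p' i \<or> \<kappa> i (p i) (p' i)))"

lemma tuple_Suc: "tuple (Suc v) p = tuple v p @ p (Suc v)"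
  by (simp add: tuple_def)

lemma length_tuple: "length (tuple v p) = (\<Sum>i=1..v. length (p i))"
  by (induction v) (auto simp: tuple_Suc tuple_def)

lemma tuple_cong: "(\<And>i. i \<in> {1..v} \<Longrightarrow> p i = q i) \<Longrightarrow> tuple v p = tuple v q"
  unfolding tuple_def by (intro arg_cong[where f = concat] map_cong) auto

lemma tuple_inject:
  assumes "\<And>i. i \<in> {1..v} \<Longrightarrow> length (p i) = length (q i)"
  shows "tuple v p = tuple v q \<longleftrightarrow> (\<forall>i\<in>{1..v}. p i = q i)"
  using assms
proof (induction v)
  case 0
  then show ?case by (simp add: tuple_def)
next
  case (Suc v)
  have "length (tuple v p) = length (tuple v q)"
    using Suc.prems by (auto simp: length_tuple intro!: sum.cong)
  with Suc show ?case
    by (auto simp: tuple_Suc atLeastAtMostSuc_conv)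
qed

lemma digital_image_length:
  "digital_image X \<kappa> \<Longrightarrow> x \<in> X \<Longrightarrow> x' \<in> X \<Longrightarrow> length x = length x'"
  by (auto simp: digital_image_def lattice_def)

lemma NP_adj_tuple:
  assumes "\<And>i. i \<in> {1..v} \<Longrightarrow> digital_image (X i) (\<kappa> i)"
    and "\<forall>i\<in>{1..v}. p i \<in> X i" and "\<forall>i\<in>{1..v}. p' i \<in> X i"
  shows "NP_adj v X \<kappa> (tuple v p) (tuple v p') \<longleftrightarrow>
    (\<exists>i\<in>{1..v}. p i \<noteq> p' i) \<and> (\<forall>i\<in>{1..v}. p i = p' i \<or> \<kappa> i (p i) (p' i))"
proof -
  have inj: "tuple v q = tuple v q' \<longleftrightarrow> (\<forall>i\<in>{1..v}. q i = q' i)"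
    if "\<forall>i\<in>{1..v}. q i \<in> X i" "\<forall>i\<in>{1..v}. q' i \<in> X i" for q q'
    using that by (intro tuple_inject) (metis assms(1) digital_image_length)
  show ?thesis
  proof
    assume "NP_adj v X \<kappa> (tuple v p) (tuple v p')"
    then obtain q q' where q: "\<forall>i\<in>{1..v}. q i \<in> X i" "\<forall>i\<in>{1..v}. q' i \<in> X i"
      "tuple v p = tuple v q" "tuple v p' = tuple v q'" "tuple v p \<noteq> tuple v p'"
      "\<forall>i\<in>{1..v}. q i = q' i \<or> \<kappa> i (q i) (q' i)"
      unfolding NP_adj_def by blast
    moreover have "\<forall>i\<in>{1..v}. p i = q i" "\<forall>i\<in>{1..v}. p' i = q' i"
      using inj q assms(2,3) by blast+
    ultimately show "(\<exists>i\<in>{1..v}. p i \<noteq> p' i) \<and> (\<forall>i\<in>{1..v}. p i = p' i \<or> \<kappa> i (p i) (p' i))"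
      using inj[OF assms(2,3)] by simp
  next
    assume "(\<exists>i\<in>{1..v}. p i \<noteq> p' i) \<and> (\<forall>i\<in>{1..v}. p i = p' i \<or> \<kappa> i (p i) (p' i))"
    then show "NP_adj v X \<kappa> (tuple v p) (tuple v p')"
      unfolding NP_adj_def using inj[OF assms(2,3)] assms(2,3) by blast
  qed
qed

lemma digital_image_prod:
  assumes "\<And>i. i \<in> {1..v} \<Longrightarrow> digital_image (X i) (\<kappa> i)"
  shows "digital_image (image_prod v X) (NP_adj v X \<kappa>)"
proof -
  have "\<forall>i\<in>{1..v}. \<exists>n. X i \<subseteq> lattice n"
    using assms by (auto simp: digital_image_def)
  then obtain n where n: "\<forall>i\<in>{1..v}. X i \<subseteq> lattice (n i)"
    by metis
  have "image_prod v X \<subseteq> lattice (\<Sum>i=1..v. n i)"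
    using n by (fastforce simp: image_prod_def lattice_def length_tuple intro!: sum.cong)
  moreover have "NP_adj v X \<kappa> z' z" if zz: "NP_adj v X \<kappa> z z'" for z z'
  proof -
    obtain p p' where p: "\<forall>i\<in>{1..v}. p i \<in> X i" "\<forall>i\<in>{1..v}. p' i \<in> X i"
      "z = tuple v p" "z' = tuple v p'" "z \<noteq> z'"
      "\<forall>i\<in>{1..v}. p i = p' i \<or> \<kappa> i (p i) (p' i)"
      using zz unfolding NP_adj_def by blast
    have "\<forall>i\<in>{1..v}. p' i = p i \<or> \<kappa> i (p' i) (p i)"
    proof
      fix i assume i: "i \<in> {1..v}"
      have "symp_on (X i) (\<kappa> i)" using assms[OF i] by (simp add: digital_image_def)
      then show "p' i = p i \<or> \<kappa> i (p' i) (p i)"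
        using p(1,2,6) i by (metis symp_onD)
    qed
    with p show ?thesis unfolding NP_adj_def by metis
  qed
  moreover have "\<not> NP_adj v X \<kappa> z z" for z
    by (auto simp: NP_adj_def)
  ultimately show ?thesis
    by (auto simp: digital_image_def intro!: symp_onI irreflp_onI)
qed

end

theory Submission imports Defs begin

text \<open>Products of the given maps and homotopies do the job once all homotopies have the same
  length, which is achieved by letting the shorter ones stand still at the end. All components
  may then move at the same time, because a point of the product is \<open>NP_adj\<close>-adjacent to every
  other point whose components are all equal or adjacent to its own.\<close>

section \<open>Prolonging homotopies in time and replacing their ends\<close>

lemma dig_homotopy_extend:
  assumes F: "dig_homotopy X \<kappa> Y \<mu> f g m F" and "m \<le> M"
  shows "dig_homotopy X \<kappa> Y \<mu> f g M (\<lambda>(x, t). F (x, min t m))"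
proof -
  have m: "m > 0" and sec: "\<And>x. x \<in> X \<Longrightarrow> dig_continuous {0..m} c1_adj Y \<mu> (\<lambda>t. F (x, t))"
    using F unfolding dig_homotopy_def by blast+
  have clamp: "min t m \<in> {0..m}" if "t \<in> {0..M}" for t
    using that m by simp
  have path: "dig_continuous {0..M} c1_adj Y \<mu> (\<lambda>t. F (x, min t m))" if x: "x \<in> X" for x
    unfolding dig_continuous_def
  proof (intro conjI ballI impI)
    show "(\<lambda>t. F (x, min t m)) \<in> {0..M} \<rightarrow> Y"
      using sec[OF x] clamp unfolding dig_continuous_def by blast
  next
    fix t t' assume t: "t \<in> {0..M}" "t' \<in> {0..M}" and adj: "c1_adj t t'"
    \<comment> \<open>Clamping times at \<open>m\<close> never increases their distance, so adjacent
      times become equal or adjacent ones and the old path condition applies.\<close>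
    have "min t m = min t' m \<or> c1_adj (min t m) (min t' m)"
      using adj unfolding c1_adj_def by linarith
    then show "F (x, min t m) = F (x, min t' m) \<or> \<mu> (F (x, min t m)) (F (x, min t' m))"
    proof
      assume "c1_adj (min t m) (min t' m)"
      then show ?thesis
        using sec[OF x] clamp[OF t(1)] clamp[OF t(2)] unfolding dig_continuous_def by blast
    qed simp
  qed
  have "(\<lambda>(x, t). F (x, min t m)) \<in> X \<times> {0..M} \<rightarrow> Y"
    using path unfolding dig_continuous_def by auto
  moreover have "\<forall>x\<in>X. F (x, min 0 m) = f x \<and> F (x, min M m) = g x"
    using F m \<open>m \<le> M\<close> by (simp add: dig_homotopy_def)
  moreover have "\<forall>t\<in>{0..M}. dig_continuous X \<kappa> Y \<mu> (\<lambda>x. F (x, min t m))"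
    using F clamp unfolding dig_homotopy_def by blast
  ultimately show ?thesis
    using F path m \<open>m \<le> M\<close> unfolding dig_homotopy_def by simp
qed

text \<open>Clamped times stay in the interval \<open>{0..m}\<close> on which \<open>F\<close> is
  constant at \<open>x\<close>. Positivity of \<open>m\<close> gives \<open>min 0 m = 0\<close>, so
  the reference value at time 0 is unchanged.\<close>

lemma holds_fixed_extend:
  assumes "holds_fixed m F x" and "m > 0"
  shows "holds_fixed M (\<lambda>(x, t). F (x, min t m)) x"
  unfolding holds_fixed_def
proof
  fix t assume "t \<in> {0..M}"
  then have "min t m \<in> {0..m}" using assms(2) by simp
  then have "F (x, min t m) = F (x, 0)"
    using assms(1) unfolding holds_fixed_def by blast
  then show "(\<lambda>(x, t). F (x, min t m)) (x, t) = (\<lambda>(x, t). F (x, min t m)) (x, 0)"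
    using assms(2) by simp
qed

lemma dig_continuous_cong:
  "(\<And>x. x \<in> X \<Longrightarrow> f x = f' x) \<Longrightarrow> dig_continuous X \<kappa> Y \<mu> f \<longleftrightarrow> dig_continuous X \<kappa> Y \<mu> f'"
  by (simp add: dig_continuous_def Pi_iff)

text \<open>Meant for products: composites of product maps agree with products of composites on the
  product set, while their values elsewhere are arbitrary. The ends of a homotopy must therefore be
  replaceable by maps that agree on \<open>X\<close>.\<close>

lemma dig_homotopy_cong:
  assumes "\<And>x. x \<in> X \<Longrightarrow> f x = f' x" "\<And>x. x \<in> X \<Longrightarrow> g x = g' x"
  shows "dig_homotopy X \<kappa> Y \<mu> f g m F \<longleftrightarrow> dig_homotopy X \<kappa> Y \<mu> f' g' m F"
  using assms dig_continuous_cong[of X f f' \<kappa> Y \<mu>] dig_continuous_cong[of X g g' \<kappa> Y \<mu>]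
  by (simp add: dig_homotopy_def)

section \<open>Coordinates and products of maps\<close>

text \<open>The components of a concatenated point are only determined when each \<open>X i\<close> lies in a lattice
  of some fixed dimension; see \<open>coord_tuple\<close>.\<close>

definition coord :: "nat \<Rightarrow> (nat \<Rightarrow> int list set) \<Rightarrow> int list \<Rightarrow> nat \<Rightarrow> int list" where
  "coord v X z = (SOME p. (\<forall>i\<in>{1..v}. p i \<in> X i) \<and> z = tuple v p)"

text \<open>Off \<open>image_prod v X\<close> the choice in \<open>coord\<close> is unconstrained,
  so the values of the map carry meaning on the product only.\<close>

definition prod_map ::
  "nat \<Rightarrow> (nat \<Rightarrow> int list set) \<Rightarrow> (nat \<Rightarrow> int list \<Rightarrow> int list) \<Rightarrow> int list \<Rightarrow> int list" where
  "prod_map v X h z = tuple v (\<lambda>i. h i (coord v X z i))"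

text \<open>The family \<open>p\<close> witnesses the choice, so the chosen family also lies in the
  sets \<open>X i\<close> and has the same concatenation. All points of one \<open>X i\<close> have
  the same length, hence both families cut the list at the same places and coincide on
  \<open>{1..v}\<close>.\<close>

lemma coord_tuple:
  assumes "\<forall>i\<in>{1..v}. digital_image (X i) (\<kappa> i)"
    and p: "\<forall>i\<in>{1..v}. p i \<in> X i" and "i \<in> {1..v}"
  shows "coord v X (tuple v p) i = p i"
proof -
  let ?q = "coord v X (tuple v p)"
  have q: "(\<forall>i\<in>{1..v}. ?q i \<in> X i) \<and> tuple v p = tuple v ?q"
    unfolding coord_def by (rule someI[where x = p]) (simp add: p)
  have "tuple v p = tuple v ?q \<longleftrightarrow> (\<forall>i\<in>{1..v}. p i = ?q i)"
    by (rule tuple_inject) (metis assms(1) digital_image_length p q)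
  with q assms(3) show ?thesis by simp
qed

lemma prod_map_tuple:
  assumes "\<forall>i\<in>{1..v}. digital_image (X i) (\<kappa> i)" and "\<forall>i\<in>{1..v}. p i \<in> X i"
  shows "prod_map v X h (tuple v p) = tuple v (\<lambda>i. h i (p i))"
  unfolding prod_map_def
  by (rule tuple_cong) (simp only: coord_tuple[where \<kappa> = \<kappa>, OF assms])

text \<open>\<open>NP_adj\<close> demands distinct points, so componentwise closeness gives
  adjacency only up to equality. That is exactly the alternative allowed by
  \<open>dig_continuous\<close>.\<close>

lemma NP_adj_tupleI:
  assumes "\<forall>i\<in>{1..v}. p i \<in> X i" "\<forall>i\<in>{1..v}. p' i \<in> X i"
    and "\<forall>i\<in>{1..v}. p i = p' i \<or> \<kappa> i (p i) (p' i)"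
  shows "tuple v p = tuple v p' \<or> NP_adj v X \<kappa> (tuple v p) (tuple v p')"
proof (cases "tuple v p = tuple v p'")
  case False
  with assms have "NP_adj v X \<kappa> (tuple v p) (tuple v p')"
    unfolding NP_adj_def by (intro exI[where x = p] exI[where x = p'] conjI refl)
  then show ?thesis ..
qed simp

text \<open>Half of the universal property of the product. The domain is left general so that it can
  be a time interval, where the lemma assembles paths in the factors into a path in the
  product.\<close>

lemma dig_continuous_tuple:
  assumes "\<forall>i\<in>{1..v}. dig_continuous T \<tau> (Y i) (\<mu> i) (h i)"
  shows "dig_continuous T \<tau> (image_prod v Y) (NP_adj v Y \<mu>) (\<lambda>t. tuple v (\<lambda>i. h i t))"
  unfolding dig_continuous_def
proof (intro conjI ballI impI)
  show "(\<lambda>t. tuple v (\<lambda>i. h i t)) \<in> T \<rightarrow> image_prod v Y"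
    using assms by (fastforce simp: dig_continuous_def image_prod_def)
next
  fix t t' assume "t \<in> T" "t' \<in> T" "\<tau> t t'"
  then show "tuple v (\<lambda>i. h i t) = tuple v (\<lambda>i. h i t') \<or>
    NP_adj v Y \<mu> (tuple v (\<lambda>i. h i t)) (tuple v (\<lambda>i. h i t'))"
    using assms by (intro NP_adj_tupleI) (auto simp: dig_continuous_def Pi_iff)
qed

text \<open>An \<open>NP_adj\<close>-adjacent pair comes with decompositions whose components are
  equal or adjacent. Each \<open>h i\<close> preserves this relation, and \<open>prod_map\<close>
  acts on these very components because they are uniquely determined.\<close>

lemma dig_continuous_prod_map:
  assumes X: "\<forall>i\<in>{1..v}. digital_image (X i) (\<kappa> i)"
    and h: "\<forall>i\<in>{1..v}. dig_continuous (X i) (\<kappa> i) (Y i) (\<mu> i) (h i)"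
  shows "dig_continuous (image_prod v X) (NP_adj v X \<kappa>) (image_prod v Y) (NP_adj v Y \<mu>)
    (prod_map v X h)"
  unfolding dig_continuous_def
proof (intro conjI ballI impI)
  note pm = prod_map_tuple[where \<kappa> = \<kappa>, OF X]
  show "prod_map v X h \<in> image_prod v X \<rightarrow> image_prod v Y"
  proof
    fix z assume "z \<in> image_prod v X"
    then obtain p where "\<forall>i\<in>{1..v}. p i \<in> X i" "z = tuple v p"
      by (auto simp: image_prod_def)
    then show "prod_map v X h z \<in> image_prod v Y"
      using h pm unfolding dig_continuous_def image_prod_def Pi_iff by blast
  qed
next
  note pm = prod_map_tuple[where \<kappa> = \<kappa>, OF X]
  fix z z' assume "NP_adj v X \<kappa> z z'"
  then obtain p p' where p: "\<forall>i\<in>{1..v}. p i \<in> X i" "\<forall>i\<in>{1..v}. p' i \<in> X i"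
    "z = tuple v p" "z' = tuple v p'" "\<forall>i\<in>{1..v}. p i = p' i \<or> \<kappa> i (p i) (p' i)"
    unfolding NP_adj_def by blast
  have "tuple v (\<lambda>i. h i (p i)) = tuple v (\<lambda>i. h i (p' i)) \<or>
    NP_adj v Y \<mu> (tuple v (\<lambda>i. h i (p i))) (tuple v (\<lambda>i. h i (p' i)))"
    using h p(1,2,5) by (intro NP_adj_tupleI) (fastforce simp: dig_continuous_def Pi_iff)+
  then show "prod_map v X h z = prod_map v X h z' \<or>
    NP_adj v Y \<mu> (prod_map v X h z) (prod_map v X h z')"
    using p pm by simp
qed

text \<open>The intermediate components \<open>f i (p i)\<close> lie in \<open>Y i\<close>, so
  \<open>coord v Y\<close> recovers them from their concatenation and the maps compose factor by
  factor.\<close>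

lemma prod_map_comp:
  assumes X: "\<forall>i\<in>{1..v}. digital_image (X i) (\<kappa> i)"
    and Y: "\<forall>i\<in>{1..v}. digital_image (Y i) (\<mu> i)"
    and f: "\<forall>i\<in>{1..v}. f i \<in> X i \<rightarrow> Y i"
    and z: "z \<in> image_prod v X"
  shows "prod_map v X (\<lambda>i. g i \<circ> f i) z = (prod_map v Y g \<circ> prod_map v X f) z"
proof -
  obtain p where p: "\<forall>i\<in>{1..v}. p i \<in> X i" "z = tuple v p"
    using z by (auto simp: image_prod_def)
  moreover have "\<forall>i\<in>{1..v}. f i (p i) \<in> Y i"
    using f p by blast
  ultimately show ?thesis
    by (simp add: prod_map_tuple[where \<kappa> = \<kappa>, OF X] prod_map_tuple[where \<kappa> = \<mu>, OF Y])
qed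

lemma prod_map_id:
  assumes X: "\<forall>i\<in>{1..v}. digital_image (X i) (\<kappa> i)" and z: "z \<in> image_prod v X"
  shows "prod_map v X (\<lambda>i. id) z = id z"
  using z by (auto simp: image_prod_def prod_map_tuple[where \<kappa> = \<kappa>, OF X])

section \<open>Products of homotopies\<close>

text \<open>At a fixed time the product homotopy is a \<open>prod_map\<close> of continuous maps; at
  a fixed point it is a tuple of continuous paths. Both continuity conditions thus come from the
  factors, and the common length \<open>M\<close> makes all components reach their ends
  together.\<close>

lemma dig_homotopy_prod:
  assumes X: "\<forall>i\<in>{1..v}. digital_image (X i) (\<kappa> i)"
    and F: "\<forall>i\<in>{1..v}. dig_homotopy (X i) (\<kappa> i) (Y i) (\<mu> i) (f i) (g i) M (F i)"
    and M: "M > 0"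
  shows "dig_homotopy (image_prod v X) (NP_adj v X \<kappa>) (image_prod v Y) (NP_adj v Y \<mu>)
    (prod_map v X f) (prod_map v X g) M (\<lambda>(z, t). prod_map v X (\<lambda>i x. F i (x, t)) z)"
proof -
  note pm = prod_map_tuple[where \<kappa> = \<kappa>, OF X]
  note cont = dig_continuous_prod_map[where \<kappa> = \<kappa>, OF X]
  have sec: "dig_continuous (image_prod v X) (NP_adj v X \<kappa>) (image_prod v Y) (NP_adj v Y \<mu>)
      (prod_map v X (\<lambda>i x. F i (x, t)))" if "t \<in> {0..M}" for t
    using F that by (intro cont) (auto simp: dig_homotopy_def)
  have ends: "prod_map v X (\<lambda>i x. F i (x, 0)) z = prod_map v X f z"
    "prod_map v X (\<lambda>i x. F i (x, M)) z = prod_map v X g z" if z: "z \<in> image_prod v X" for z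
  proof -
    obtain p where p: "\<forall>i\<in>{1..v}. p i \<in> X i" and zp: "z = tuple v p"
      using z by (auto simp: image_prod_def)
    show "prod_map v X (\<lambda>i x. F i (x, 0)) z = prod_map v X f z"
      "prod_map v X (\<lambda>i x. F i (x, M)) z = prod_map v X g z"
      unfolding zp pm[OF p] using F p by (auto simp: dig_homotopy_def intro!: tuple_cong)
  qed
  have path: "dig_continuous {0..M} c1_adj (image_prod v Y) (NP_adj v Y \<mu>)
      (\<lambda>t. prod_map v X (\<lambda>i x. F i (x, t)) z)" if z: "z \<in> image_prod v X" for z
  proof -
    obtain p where p: "\<forall>i\<in>{1..v}. p i \<in> X i" and zp: "z = tuple v p"
      using z by (auto simp: image_prod_def)
    show ?thesis
      unfolding zp pm[OF p] using F p
      by (intro dig_continuous_tuple) (auto simp: dig_homotopy_def)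
  qed
  have "dig_continuous (image_prod v X) (NP_adj v X \<kappa>) (image_prod v Y) (NP_adj v Y \<mu>)
      (prod_map v X f)"
    "dig_continuous (image_prod v X) (NP_adj v X \<kappa>) (image_prod v Y) (NP_adj v Y \<mu>)
      (prod_map v X g)"
    using F by (intro cont; simp add: dig_homotopy_def)+
  then show ?thesis
    using M sec ends path by (auto simp: dig_homotopy_def dig_continuous_def Pi_iff)
qed

text \<open>The base point is quantified after \<open>M\<close> and \<open>H\<close>, so a single
  homotopy holds fixed every tuple of points fixed in the factors. The unpointed and the pointed
  case can then share the construction.\<close>

lemma dig_homotopy_prod_common_length:
  assumes X: "\<forall>i\<in>{1..v}. digital_image (X i) (\<kappa> i)"
    and F: "\<forall>i\<in>{1..v}. dig_homotopy (X i) (\<kappa> i) (Y i) (\<mu> i) (f i) (g i) (m i) (F i)"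
  obtains M H where
    "dig_homotopy (image_prod v X) (NP_adj v X \<kappa>) (image_prod v Y) (NP_adj v Y \<mu>)
       (prod_map v X f) (prod_map v X g) M H"
    "\<And>x. \<forall>i\<in>{1..v}. x i \<in> X i \<and> holds_fixed (m i) (F i) (x i) \<Longrightarrow>
       holds_fixed M H (tuple v x)"
proof -
  \<comment> \<open>The lengths are positive, so their sum bounds each of them. The added 1 makes
    \<open>M\<close> positive as soon as the sum is nonnegative, an empty sum included.\<close>
  define M where "M = 1 + (\<Sum>i=1..v. m i)"
  define G where "G = (\<lambda>i (x, t). F i (x, min t (m i)))"
  define H where "H = (\<lambda>(z, t). prod_map v X (\<lambda>i x. G i (x, t)) z)"
  have m: "m i > 0" if "i \<in> {1..v}" for i
    using F that unfolding dig_homotopy_def by blast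
  have "0 \<le> (\<Sum>i=1..v. m i)"
    by (rule sum_nonneg) (rule less_imp_le, rule m)
  then have "M > 0" by (simp add: M_def)
  have le: "m i \<le> M" if "i \<in> {1..v}" for i
  proof -
    have "m i \<le> (\<Sum>i=1..v. m i)"
      by (rule member_le_sum[OF that]) (use m in \<open>auto intro: less_imp_le\<close>)
    then show ?thesis by (simp add: M_def)
  qed
  have G: "dig_homotopy (X i) (\<kappa> i) (Y i) (\<mu> i) (f i) (g i) M (G i)" if "i \<in> {1..v}" for i
    unfolding G_def using F le[OF that] that by (intro dig_homotopy_extend) auto
  have hom: "dig_homotopy (image_prod v X) (NP_adj v X \<kappa>) (image_prod v Y) (NP_adj v Y \<mu>)
      (prod_map v X f) (prod_map v X g) M H"
    unfolding H_def using G \<open>M > 0\<close> by (intro dig_homotopy_prod X) auto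
  have fixed: "holds_fixed M H (tuple v x)"
    if x: "\<forall>i\<in>{1..v}. x i \<in> X i \<and> holds_fixed (m i) (F i) (x i)" for x
  proof -
    have "holds_fixed M (G i) (x i)" if "i \<in> {1..v}" for i
      unfolding G_def by (rule holds_fixed_extend[OF _ m[OF that]]) (use x that in blast)
    then have const: "G i (x i, t) = G i (x i, 0)" if "i \<in> {1..v}" "t \<in> {0..M}" for i t
      using that unfolding holds_fixed_def by blast
    \<comment> \<open>On a tuple \<open>H\<close> acts componentwise at every time, so the constancy
      of each component passes to \<open>H\<close>.\<close>
    have "H (tuple v x, t) = tuple v (\<lambda>i. G i (x i, t))" for t
      using x by (simp add: H_def prod_map_tuple[where \<kappa> = \<kappa>, OF X])
    then show ?thesis
      unfolding holds_fixed_def by (simp only:) (intro ballI tuple_cong const)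
  qed
  from hom fixed show ?thesis by (rule that)
qed

section \<open>Products of homotopy equivalences\<close>

text \<open>This is one side of a homotopy equivalence; the other is obtained by exchanging
  \<open>X\<close> with \<open>Y\<close> and \<open>f\<close> with \<open>g\<close>. Multiplying the
  given homotopies leads from the product of the composites to the product of the
  identities.\<close>

lemma dig_homotopic_prod_inverse:
  assumes X: "\<forall>i\<in>{1..v}. digital_image (X i) (\<kappa> i)"
    and Y: "\<forall>i\<in>{1..v}. digital_image (Y i) (\<mu> i)"
    and f: "\<forall>i\<in>{1..v}. f i \<in> X i \<rightarrow> Y i"
  shows "(\<forall>i\<in>{1..v}. dig_homotopic (X i) (\<kappa> i) (X i) (\<kappa> i) (g i \<circ> f i) id) \<Longrightarrow>
      dig_homotopic (image_prod v X) (NP_adj v X \<kappa>) (image_prod v X) (NP_adj v X \<kappa>)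
        (prod_map v Y g \<circ> prod_map v X f) id" (is "PROP ?free")
    and "(\<forall>i\<in>{1..v}. x i \<in> X i) \<Longrightarrow>
      (\<forall>i\<in>{1..v}.
        dig_homotopic_fixing (x i) (X i) (\<kappa> i) (X i) (\<kappa> i) (g i \<circ> f i) id) \<Longrightarrow>
      dig_homotopic_fixing (tuple v x)
        (image_prod v X) (NP_adj v X \<kappa>) (image_prod v X) (NP_adj v X \<kappa>)
        (prod_map v Y g \<circ> prod_map v X f) id" (is "PROP ?fixing")
proof -
  \<comment> \<open>The same \<open>H\<close> serves on both sides. Only its ends are rewritten,
    which is legitimate because they agree on \<open>image_prod v X\<close>.\<close>
  have cong: "dig_homotopy (image_prod v X) (NP_adj v X \<kappa>) (image_prod v X) (NP_adj v X \<kappa>)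
      (prod_map v X (\<lambda>i. g i \<circ> f i)) (prod_map v X (\<lambda>i. id)) M H \<longleftrightarrow>
    dig_homotopy (image_prod v X) (NP_adj v X \<kappa>) (image_prod v X) (NP_adj v X \<kappa>)
      (prod_map v Y g \<circ> prod_map v X f) id M H" for M H
    by (rule dig_homotopy_cong)
      (auto simp: prod_map_comp[where \<kappa> = \<kappa> and \<mu> = \<mu>, OF X Y f]
        prod_map_id[where \<kappa> = \<kappa>, OF X] simp del: o_apply)
  show "PROP ?free"
  proof -
    assume "\<forall>i\<in>{1..v}. dig_homotopic (X i) (\<kappa> i) (X i) (\<kappa> i) (g i \<circ> f i) id"
    then obtain m F where
      "\<forall>i\<in>{1..v}. dig_homotopy (X i) (\<kappa> i) (X i) (\<kappa> i) (g i \<circ> f i) id (m i) (F i)"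
      unfolding dig_homotopic_def by metis
    from dig_homotopy_prod_common_length[OF X this] obtain M H where
      "dig_homotopy (image_prod v X) (NP_adj v X \<kappa>) (image_prod v X) (NP_adj v X \<kappa>)
        (prod_map v X (\<lambda>i. g i \<circ> f i)) (prod_map v X (\<lambda>i. id)) M H"
      by blast
    then show ?thesis
      unfolding cong dig_homotopic_def by blast
  qed
  show "PROP ?fixing"
  proof -
    assume x: "\<forall>i\<in>{1..v}. x i \<in> X i"
      and "\<forall>i\<in>{1..v}.
        dig_homotopic_fixing (x i) (X i) (\<kappa> i) (X i) (\<kappa> i) (g i \<circ> f i) id"
    then obtain m F where
      F: "\<forall>i\<in>{1..v}. dig_homotopy (X i) (\<kappa> i) (X i) (\<kappa> i) (g i \<circ> f i) id (m i) (F i)"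
      and fixed: "\<forall>i\<in>{1..v}. holds_fixed (m i) (F i) (x i)"
      unfolding dig_homotopic_fixing_def by metis
    from dig_homotopy_prod_common_length[OF X F] obtain M H where
      "dig_homotopy (image_prod v X) (NP_adj v X \<kappa>) (image_prod v X) (NP_adj v X \<kappa>)
        (prod_map v X (\<lambda>i. g i \<circ> f i)) (prod_map v X (\<lambda>i. id)) M H"
      "holds_fixed M H (tuple v x)"
      using x fixed by metis
    then show ?thesis
      unfolding cong dig_homotopic_fixing_def by blast
  qed
qed

lemma same_homotopy_type_prod:
  assumes X: "\<forall>i\<in>{1..v}. digital_image (X i) (\<kappa> i)"
    and Y: "\<forall>i\<in>{1..v}. digital_image (Y i) (\<mu> i)"
    and "\<forall>i\<in>{1..v}. same_homotopy_type (X i) (\<kappa> i) (Y i) (\<mu> i)"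
  shows "same_homotopy_type (image_prod v X) (NP_adj v X \<kappa>) (image_prod v Y) (NP_adj v Y \<mu>)"
proof -
  have "\<forall>i\<in>{1..v}. \<exists>f g. dig_continuous (X i) (\<kappa> i) (Y i) (\<mu> i) f \<and>
      dig_continuous (Y i) (\<mu> i) (X i) (\<kappa> i) g \<and>
      dig_homotopic (X i) (\<kappa> i) (X i) (\<kappa> i) (g \<circ> f) id \<and>
      dig_homotopic (Y i) (\<mu> i) (Y i) (\<mu> i) (f \<circ> g) id"
    using assms(3) unfolding same_homotopy_type_def by blast
  then obtain f g where
    f: "\<forall>i\<in>{1..v}. dig_continuous (X i) (\<kappa> i) (Y i) (\<mu> i) (f i)" and
    g: "\<forall>i\<in>{1..v}. dig_continuous (Y i) (\<mu> i) (X i) (\<kappa> i) (g i)" and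
    gf: "\<forall>i\<in>{1..v}. dig_homotopic (X i) (\<kappa> i) (X i) (\<kappa> i) (g i \<circ> f i) id" and
    fg: "\<forall>i\<in>{1..v}. dig_homotopic (Y i) (\<mu> i) (Y i) (\<mu> i) (f i \<circ> g i) id"
    by metis
  have maps: "\<forall>i\<in>{1..v}. f i \<in> X i \<rightarrow> Y i" "\<forall>i\<in>{1..v}. g i \<in> Y i \<rightarrow> X i"
    using f g unfolding dig_continuous_def by blast+
  show ?thesis
    unfolding same_homotopy_type_def
    using dig_continuous_prod_map[OF X f] dig_continuous_prod_map[OF Y g]
      dig_homotopic_prod_inverse(1)[OF X Y maps(1) gf]
      dig_homotopic_prod_inverse(1)[OF Y X maps(2) fg]
    by blast
qed

text \<open>The maps are chosen afresh from the pointed hypothesis, since equivalences witnessing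
  the bare homotopy type need not respect the base points. Products of the chosen maps match the
  base tuples component by component.\<close>

lemma pointed_same_homotopy_type_prod:
  assumes X: "\<forall>i\<in>{1..v}. digital_image (X i) (\<kappa> i)"
    and Y: "\<forall>i\<in>{1..v}. digital_image (Y i) (\<mu> i)"
    and pointed: "\<forall>i\<in>{1..v}.
      pointed_same_homotopy_type (X i) (\<kappa> i) (x i) (Y i) (\<mu> i) (y i)"
  shows "pointed_same_homotopy_type (image_prod v X) (NP_adj v X \<kappa>) (tuple v x)
    (image_prod v Y) (NP_adj v Y \<mu>) (tuple v y)"
proof -
  have x: "\<forall>i\<in>{1..v}. x i \<in> X i" and y: "\<forall>i\<in>{1..v}. y i \<in> Y i"
    using pointed unfolding pointed_same_homotopy_type_def by blast+
  have "\<forall>i\<in>{1..v}. \<exists>f g. dig_continuous (X i) (\<kappa> i) (Y i) (\<mu> i) f \<and>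
      dig_continuous (Y i) (\<mu> i) (X i) (\<kappa> i) g \<and> f (x i) = y i \<and> g (y i) = x i \<and>
      dig_homotopic_fixing (x i) (X i) (\<kappa> i) (X i) (\<kappa> i) (g \<circ> f) id \<and>
      dig_homotopic_fixing (y i) (Y i) (\<mu> i) (Y i) (\<mu> i) (f \<circ> g) id"
    using pointed unfolding pointed_same_homotopy_type_def by blast
  then obtain f g where
    f: "\<forall>i\<in>{1..v}. dig_continuous (X i) (\<kappa> i) (Y i) (\<mu> i) (f i)" and
    g: "\<forall>i\<in>{1..v}. dig_continuous (Y i) (\<mu> i) (X i) (\<kappa> i) (g i)" and
    fx: "\<forall>i\<in>{1..v}. f i (x i) = y i" and gy: "\<forall>i\<in>{1..v}. g i (y i) = x i" and
    gf: "\<forall>i\<in>{1..v}.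
      dig_homotopic_fixing (x i) (X i) (\<kappa> i) (X i) (\<kappa> i) (g i \<circ> f i) id" and
    fg: "\<forall>i\<in>{1..v}.
      dig_homotopic_fixing (y i) (Y i) (\<mu> i) (Y i) (\<mu> i) (f i \<circ> g i) id"
    unfolding bchoice_iff by blast
  have maps: "\<forall>i\<in>{1..v}. f i \<in> X i \<rightarrow> Y i" "\<forall>i\<in>{1..v}. g i \<in> Y i \<rightarrow> X i"
    using f g unfolding dig_continuous_def by blast+
  have "prod_map v X f (tuple v x) = tuple v y" "prod_map v Y g (tuple v y) = tuple v x"
    unfolding prod_map_tuple[where \<kappa> = \<kappa>, OF X x] prod_map_tuple[where \<kappa> = \<mu>, OF Y y]
    using fx gy by (auto intro!: tuple_cong)
  moreover have "tuple v x \<in> image_prod v X" "tuple v y \<in> image_prod v Y"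
    using x y by (auto simp: image_prod_def)
  ultimately show ?thesis
    unfolding pointed_same_homotopy_type_def
    using dig_continuous_prod_map[OF X f] dig_continuous_prod_map[OF Y g]
      dig_homotopic_prod_inverse(2)[OF X Y maps(1) x gf]
      dig_homotopic_prod_inverse(2)[OF Y X maps(2) y fg]
    by blast
qed

theorem theorem6p2:
  fixes v :: nat
    and X Y :: "nat \<Rightarrow> int list set"
    and \<kappa> \<mu> :: "nat \<Rightarrow> int list \<Rightarrow> int list \<Rightarrow> bool"
  assumes "v \<ge> 1"
    and "\<And>i. i \<in> {1..v} \<Longrightarrow> digital_image (X i) (\<kappa> i)"
    and "\<And>i. i \<in> {1..v} \<Longrightarrow> digital_image (Y i) (\<mu> i)"
    and "\<And>i. i \<in> {1..v} \<Longrightarrow> same_homotopy_type (X i) (\<kappa> i) (Y i) (\<mu> i)"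
  shows "same_homotopy_type (image_prod v X) (NP_adj v X \<kappa>) (image_prod v Y) (NP_adj v Y \<mu>) \<and>
    (\<forall>x y. (\<forall>i\<in>{1..v}. x i \<in> X i \<and> y i \<in> Y i \<and>
                pointed_same_homotopy_type (X i) (\<kappa> i) (x i) (Y i) (\<mu> i) (y i)) \<longrightarrow>
       pointed_same_homotopy_type (image_prod v X) (NP_adj v X \<kappa>) (tuple v x)
                                  (image_prod v Y) (NP_adj v Y \<mu>) (tuple v y))"
  using same_homotopy_type_prod[of v X \<kappa> Y \<mu>] assms(2-4) pointed_same_homotopy_type_prod[of v X \<kappa> Y \<mu>]
  by blast

end
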